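(* Let $\mathbf U^0,\dots,\mathbf U^M\in\mathbb R^{N-1}$ satisfy the Crank--Nicolson scheme $$\frac{\mathbf U^{n+1}-\mathbf U^n}{\tau}+A_h\frac{\mathbf U^{n+1}+\mathbf U^n}{2}=r^{n+\frac12}\mathbf F^{n+\frac12},\qquad n=0,\dots,M-1,$$ and put $\mathbf U^{n+1/2}=(\mathbf U^{n+1}+\mathbf U^n)/2$. Then the following hold for every $\tau>0$ (no restriction relating $\tau$ and $h$). (i) (Homogeneous case) If $\mathbf F^{n+1/2}=0$, then $$\|\mathbf U^{n+1}\|_h^2+2\tau\|\mathbf U^{n+1/2}\|_{A_h,h}^2=\|\mathbf U^n\|_h^2 .$$ (ii) ($L^2_h$ stability with forcing) For every $0\le n\le M$, $$\|\mathbf U^n\|_h\le\|\mathbf U^0\|_h+\sum_{k=0}^{n-1}\tau\,|r^{k+1/2}|\,\|\mathbf F^{k+1/2}\|_h .$$ (iii) (Energy estimate) For every $0\le n\le M$, $$\|\mathbf U^n\|_h^2+\sum_{k=0}^{n-1}\tau\|\mathbf U^{k+1/2}\|_{A_h,h}^2\le\|\mathbf U^0\|_h^2+\sum_{k=0}^{n-1}\tau|r^{k+1/2}|^2\,\|\mathbf F^{k+1/2}\|_{A_h^{-1},h}^2 .$$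
   Context: Let $l,T>0$, $0<s<1$, $N\ge2$ and $M\ge1$ integers, $h=l/N$, $x_i=ih$, $\tau=T/M$, $t_n=n\tau$, $t_{n+\frac12}=(t_n+t_{n+1})/2$. For $\mathbf v,\mathbf z\in\mathbb R^{N-1}$ set $\langle\mathbf v,\mathbf z\rangle_h=h\sum_{i=1}^{N-1}v_iz_i$ and $\|\mathbf v\|_h^2=\langle\mathbf v,\mathbf v\rangle_h$. $L_h\in\mathbb R^{(N-1)\times(N-1)}$ is the Dirichlet difference Laplacian: the tridiagonal matrix $\frac1{h^2}\,\mathrm{tridiag}(-1,2,-1)$. It is diagonalised as $L_h=Q\Lambda_hQ^T$ with $Q_{ik}=\sqrt{2/N}\,\sin(ik\pi/N)$, $Q^TQ=I$, $\Lambda_h=\mathrm{diag}(\lambda_{1,h},\dots,\lambda_{N-1,h})$, $\lambda_{k,h}=\frac4{h^2}\sin^2\left(\frac{k\pi}{2N}\right)$. The discrete spectral fractional Laplacian is $A_h:=L_h^s=Q\Lambda_h^sQ^T$, with $\Lambda_h^s=\mathrm{diag}(\lambda_{1,h}^s,\dots,\lambda_{N-1,h}^s)$; it is symmetric positive definite. Norms: $\|\mathbf v\|_{A_h,h}^2=\langle A_h\mathbf v,\mathbf v\rangle_h$ and $\|\mathbf g\|_{A_h^{-1},h}^2=\langle A_h^{-1}\mathbf g,\mathbf g\rangle_h$. Data: given real functions $r$ on $[0,T]$ and $f$ on $[0,T]\times(0,l)$, put $r^{n+\frac12}=r(t_{n+\frac12})$ and $\mathbf F^{n+\frac12}=(f(t_{n+\frac12},x_i))_{i=1}^{N-1}$.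 *)

theory Defs
  imports Complex_Main "Jordan_Normal_Form.Gauss_Jordan_Elimination" "Jordan_Normal_Form.Determinant"
begin

text \<open>
  Vectors in \<open>\<real>^(N-1)\<close> are elements of \<open>carrier_vec (N - 1)\<close>. Since \<open>vec\<close> and \<open>mat\<close> are
  indexed from 0, the mathematical index \<open>i \<in> {1..N-1}\<close> is stored at position \<open>i - 1\<close>;
  hence the occurrences of \<open>Suc\<close> below.
\<close>

definition inner_h :: "real \<Rightarrow> real vec \<Rightarrow> real vec \<Rightarrow> real" where
  "inner_h h v z = h * (v \<bullet> z)"

definition norm_h :: "real \<Rightarrow> real vec \<Rightarrow> real" where
  "norm_h h v = sqrt (inner_h h v v)"

text \<open>The weighted norm \<open>\<parallel>v\<parallel>_{B,h}\<close>, used for \<open>B = A_h\<close> and \<open>B = A_h^{-1}\<close>.\<close>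

definition mat_norm_h :: "real \<Rightarrow> real mat \<Rightarrow> real vec \<Rightarrow> real" where
  "mat_norm_h h B v = sqrt (inner_h h (B *\<^sub>v v) v)"

definition laplacian :: "nat \<Rightarrow> real \<Rightarrow> real mat" where
  "laplacian N h = (1 / h^2) \<cdot>\<^sub>m mat (N - 1) (N - 1) (\<lambda>(i, j).
     if i = j then 2 else if i = Suc j \<or> j = Suc i then -1 else 0)"

definition sine_mat :: "nat \<Rightarrow> real mat" where
  "sine_mat N = mat (N - 1) (N - 1) (\<lambda>(i, k).
     sqrt (2 / real N) * sin (real (Suc i) * real (Suc k) * pi / real N))"

text \<open>\<open>laplacian_ev N h k\<close> is \<open>\<lambda>_{k,h}\<close>, with the mathematical index \<open>k \<in> {1..N-1}\<close>.\<close>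

definition laplacian_ev :: "nat \<Rightarrow> real \<Rightarrow> nat \<Rightarrow> real" where
  "laplacian_ev N h k = 4 / h^2 * (sin (real k * pi / (2 * real N)))^2"

definition frac_laplacian :: "nat \<Rightarrow> real \<Rightarrow> real \<Rightarrow> real mat" where
  "frac_laplacian N h s =
     sine_mat N * mat_diag (N - 1) (\<lambda>k. laplacian_ev N h (Suc k) powr s) * transpose_mat (sine_mat N)"

text \<open>
  \<open>mat_inverse\<close> returns an option; \<open>mat_inverse_frac_laplacian\<close> below shows that it is
  never \<open>None\<close> for \<open>h \<noteq> 0\<close>.
\<close>

definition frac_laplacian_inv :: "nat \<Rightarrow> real \<Rightarrow> real \<Rightarrow> real mat" where
  "frac_laplacian_inv N h s = the (mat_inverse (frac_laplacian N h s))"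

definition time_pt :: "real \<Rightarrow> nat \<Rightarrow> real" where
  "time_pt \<tau> n = real n * \<tau>"

definition half_time :: "real \<Rightarrow> nat \<Rightarrow> real" where
  "half_time \<tau> n = (time_pt \<tau> n + time_pt \<tau> (Suc n)) / 2"

definition forcing :: "nat \<Rightarrow> real \<Rightarrow> real \<Rightarrow> (real \<Rightarrow> real \<Rightarrow> real) \<Rightarrow> nat \<Rightarrow> real vec" where
  "forcing N h \<tau> f n = vec (N - 1) (\<lambda>i. f (half_time \<tau> n) (real (Suc i) * h))"

definition midpoint_vec :: "(nat \<Rightarrow> real vec) \<Rightarrow> nat \<Rightarrow> real vec" where
  "midpoint_vec U n = (1 / 2) \<cdot>\<^sub>v (U (Suc n) + U n)"

definition crank_nicolson ::
  "nat \<Rightarrow> nat \<Rightarrow> real \<Rightarrow> real \<Rightarrow> real \<Rightarrow> (real \<Rightarrow> real) \<Rightarrow> (real \<Rightarrow> real \<Rightarrow> real) \<Rightarrow> (nat \<Rightarrow> real vec) \<Rightarrow> bool" where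
  "crank_nicolson N M h \<tau> s r f U \<longleftrightarrow>
     (\<forall>n\<le>M. U n \<in> carrier_vec (N - 1)) \<and>
     (\<forall>n<M. (1 / \<tau>) \<cdot>\<^sub>v (U (Suc n) - U n) + frac_laplacian N h s *\<^sub>v midpoint_vec U n =
             r (half_time \<tau> n) \<cdot>\<^sub>v forcing N h \<tau> f n)"

text \<open>
  The diagonalisation \<open>L_h = Q \<Lambda>_h Q^T\<close>, \<open>Q^T Q = I\<close> on which the definition of
  \<open>L_h^s\<close> rests.
\<close>

lemma sum_cos_grid:
  fixes p :: int and N :: nat
  assumes "N > 0" "p \<noteq> 0" "\<bar>p\<bar> < 2 * int N"
  shows "(\<Sum>m<N. cos (real m * (of_int p * pi / real N))) = (1 - cos (of_int p * pi)) / 2"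
proof -
  define \<theta> where "\<theta> = of_int p * pi / real N"
  have tele: "2 * sin (\<theta>/2) * (\<Sum>m<K. cos (real m * \<theta>)) = sin (real K * \<theta> - \<theta>/2) + sin (\<theta>/2)" for K
  proof (induction K)
    case (Suc K)
    have "2 * sin (\<theta>/2) * cos (real K * \<theta>) = sin (real K * \<theta> + \<theta>/2) - sin (real K * \<theta> - \<theta>/2)"
      by (simp add: sin_add sin_diff)
    moreover have "real (Suc K) * \<theta> - \<theta>/2 = real K * \<theta> + \<theta>/2" by (simp add: field_simps)
    ultimately show ?case using Suc by (simp only: sum.lessThan_Suc distrib_left)
  qed simp
  have N\<theta>: "real N * \<theta> = of_int p * pi" using assms(1) by (simp add: \<theta>_def)
  have nz: "sin (\<theta>/2) \<noteq> 0"
  proof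
    assume "sin (\<theta>/2) = 0"
    then obtain i :: int where i: "\<theta>/2 = of_int i * pi" by (auto simp: sin_zero_iff_int2)
    then have "of_int p * pi = of_int (2 * int N * i) * pi" using N\<theta> by (simp add: algebra_simps)
    then have "real_of_int p = of_int (2 * int N * i)" by (metis mult_cancel_right pi_neq_zero)
    then have p: "p = 2 * int N * i" by (simp only: of_int_eq_iff)
    then have "i \<noteq> 0" using assms(2) by auto
    then have "2 * int N * 1 \<le> 2 * int N * \<bar>i\<bar>" by (intro mult_left_mono) auto
    then show False using assms(3) p by (simp add: abs_mult)
  qed
  have "2 * sin (\<theta>/2) * (\<Sum>m<N. cos (real m * \<theta>)) = sin (\<theta>/2) * (1 - cos (of_int p * pi))"
  proof -
    have "sin (of_int p * pi) = 0" by (simp add: sin_times_pi_eq_0)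
    then show ?thesis unfolding tele N\<theta> sin_diff by (simp only: mult_zero_left) (simp add: right_diff_distrib)
  qed
  then have "sin (\<theta>/2) * (2 * (\<Sum>m<N. cos (real m * \<theta>))) = sin (\<theta>/2) * (1 - cos (of_int p * pi))"
    by (simp only: mult_ac)
  then have "2 * (\<Sum>m<N. cos (real m * \<theta>)) = 1 - cos (of_int p * pi)"
    using mult_left_cancel[OF nz] by blast
  moreover have "a = b / 2" if "2 * a = b" for a b :: real using that by simp
  ultimately show ?thesis unfolding \<theta>_def by blast
qed

lemma sine_mat_carrier [simp]: "sine_mat N \<in> carrier_mat (N - 1) (N - 1)"
  by (simp add: sine_mat_def)

lemma sine_mat_orth: "transpose_mat (sine_mat N) * sine_mat N = 1\<^sub>m (N - 1)"
proof (rule eq_matI)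
  fix j k assume "j < dim_row (1\<^sub>m (N - 1) :: real mat)" "k < dim_col (1\<^sub>m (N - 1) :: real mat)"
  then have jk: "j < N - 1" "k < N - 1" by simp_all
  then have N: "N > 0" by simp
  let ?a = "\<lambda>m. real m * (real (Suc j) * pi / real N)" and ?b = "\<lambda>m. real m * (real (Suc k) * pi / real N)"
  let ?p = "int j - int k" and ?q = "int j + int k + 2"
  let ?C = "\<lambda>p::int. \<Sum>m<N. cos (real m * (of_int p * pi / real N))"
  have sh: "(\<Sum>i<N - 1. g (Suc i)) = (\<Sum>m<N. g m)" if "g 0 = 0" for g :: "nat \<Rightarrow> real"
  proof -
    have "(\<Sum>m<Suc (N - 1). g m) = g 0 + (\<Sum>i<N - 1. g (Suc i))" by (rule sum.lessThan_Suc_shift)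
    then show ?thesis using N that by simp
  qed
  have "(transpose_mat (sine_mat N) * sine_mat N) $$ (j, k) =
      (\<Sum>i<N - 1. 2 / real N * (sin (?a (Suc i)) * sin (?b (Suc i))))"
  proof -
    have sq: "sqrt (2 / real N) * x * (sqrt (2 / real N) * y) = 2 / real N * (x * y)" for x y
    proof -
      have "sqrt (2 / real N) * x * (sqrt (2 / real N) * y) = (sqrt (2 / real N) * sqrt (2 / real N)) * (x * y)"
        by (simp only: mult_ac)
      then show ?thesis by (simp only: real_sqrt_mult_self) simp
    qed
    show ?thesis using jk
      by (simp add: sine_mat_def scalar_prod_def atLeast0LessThan sq del: of_nat_Suc real_sqrt_divide)
        (simp add: mult.assoc del: of_nat_Suc)
  qed
  also have "\<dots> = 2 / real N * (\<Sum>i<N - 1. sin (?a (Suc i)) * sin (?b (Suc i)))"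
    by (rule sum_distrib_left[symmetric])
  also have "(\<Sum>i<N - 1. sin (?a (Suc i)) * sin (?b (Suc i))) = (\<Sum>m<N. sin (?a m) * sin (?b m))"
    by (rule sh) simp
  also have "\<dots> = (\<Sum>m<N. (cos (real m * (of_int ?p * pi / real N)) - cos (real m * (of_int ?q * pi / real N))) / 2)"
  proof (rule sum.cong)
    fix m
    have "real m * (of_int ?p * pi / real N) = ?a m - ?b m" "real m * (of_int ?q * pi / real N) = ?a m + ?b m"
      by (simp_all add: algebra_simps add_divide_distrib diff_divide_distrib)
    then show "sin (?a m) * sin (?b m) = (cos (real m * (of_int ?p * pi / real N)) - cos (real m * (of_int ?q * pi / real N))) / 2"
      by (simp only: sin_times_sin)
  qed simp
  also have "\<dots> = (?C ?p - ?C ?q) / 2" by (simp only: sum_divide_distrib[symmetric] sum_subtractf)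
  also have "?C ?q = (1 - cos (of_int ?q * pi)) / 2"
    by (rule sum_cos_grid) (use jk in auto)
  also have "cos (of_int ?q * pi) = cos (of_int ?p * pi)"
  proof -
    have "of_int ?q * pi = of_int ?p * pi + 2 * pi * of_int (int k + 1)" by (simp add: algebra_simps)
    then show ?thesis by (simp only: cos_add sin_int_2pin cos_int_2pin)
  qed
  also have "?C ?p = (if j = k then real N else (1 - cos (of_int ?p * pi)) / 2)"
  proof (cases "j = k")
    case False
    have "?C ?p = (1 - cos (of_int ?p * pi)) / 2"
      by (rule sum_cos_grid) (use jk False in auto)
    then show ?thesis using False by simp
  qed simp
  finally show "(transpose_mat (sine_mat N) * sine_mat N) $$ (j, k) = 1\<^sub>m (N - 1) $$ (j, k)"
    using jk N by (auto split: if_splits)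
qed (simp_all add: sine_mat_def)

lemma sine_mat_orth': "sine_mat N * transpose_mat (sine_mat N) = 1\<^sub>m (N - 1)"
  by (rule mat_mult_left_right_inverse[OF _ _ sine_mat_orth])
    (simp_all only: sine_mat_carrier transpose_carrier_mat)

lemma laplacian_sine_mat:
  "laplacian N h * sine_mat N = sine_mat N * mat_diag (N - 1) (\<lambda>k. laplacian_ev N h (Suc k))"
proof (rule eq_matI)
  fix i k assume "i < dim_row (sine_mat N * mat_diag (N - 1) (\<lambda>k. laplacian_ev N h (Suc k)))"
    "k < dim_col (sine_mat N * mat_diag (N - 1) (\<lambda>k. laplacian_ev N h (Suc k)))"
  then have ik: "i < N - 1" "k < N - 1" by (simp_all add: sine_mat_def mat_diag_def)
  define \<theta> where "\<theta> = real (Suc k) * pi / real N"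
  define g where "g m = sqrt (2 / real N) * sin (real m * \<theta>)" for m :: nat
  have g0: "g 0 = 0" by (simp add: g_def)
  have "real N * \<theta> = real (Suc k) * pi" using ik by (simp add: \<theta>_def)
  then have gN: "g N = 0" by (simp only: g_def sin_npi mult_zero_right)
  have Q: "sine_mat N $$ (j, k) = g (Suc j)" if "j < N - 1" for j
    using that ik by (simp add: sine_mat_def g_def \<theta>_def mult.assoc del: of_nat_Suc)
  have "(laplacian N h * sine_mat N) $$ (i, k) = (\<Sum>j<N - 1. laplacian N h $$ (i, j) * sine_mat N $$ (j, k))"
    using ik by (simp add: scalar_prod_def atLeast0LessThan laplacian_def sine_mat_def)
  also have "\<dots> = (\<Sum>j<N - 1. 1 / h^2 * ((if j = i then 2 * g (Suc j) else 0)
      - (if Suc j = i then g (Suc j) else 0) - (if j = Suc i then g (Suc j) else 0)))"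
    using ik by (intro sum.cong) (auto simp: laplacian_def Q)
  also have "\<dots> = 1 / h^2 * ((\<Sum>j<N - 1. if j = i then 2 * g (Suc j) else 0)
      - (\<Sum>j<N - 1. if Suc j = i then g (Suc j) else 0) - (\<Sum>j<N - 1. if j = Suc i then g (Suc j) else 0))"
    by (simp only: sum_distrib_left[symmetric] sum_subtractf)
  also have "(\<Sum>j<N - 1. if j = i then 2 * g (Suc j) else 0) = 2 * g (Suc i)"
    using ik by (simp add: sum.delta)
  also have "(\<Sum>j<N - 1. if Suc j = i then g (Suc j) else 0) = g i"
    using ik g0 by (cases i) (simp_all add: sum.delta)
  also have "(\<Sum>j<N - 1. if j = Suc i then g (Suc j) else 0) = g (Suc (Suc i))"
  proof (cases "Suc i < N - 1")
    case False
    then have "Suc (Suc i) = N" using ik by simp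
    then show ?thesis using False gN by (simp add: sum.delta)
  qed (simp add: sum.delta)
  also have "2 * g (Suc i) - g i - g (Suc (Suc i)) = g (Suc i) * (4 * (sin (\<theta> / 2))^2)"
  proof -
    have a: "real i * \<theta> = real (Suc i) * \<theta> - \<theta>" "real (Suc (Suc i)) * \<theta> = real (Suc i) * \<theta> + \<theta>"
      by (simp_all add: algebra_simps)
    have c: "cos \<theta> = 1 - 2 * (sin (\<theta> / 2))^2" using cos_double_sin[of "\<theta> / 2"] by simp
    show ?thesis unfolding g_def a sin_add sin_diff c by (simp only: algebra_simps)
  qed
  also have "1 / h^2 * (g (Suc i) * (4 * (sin (\<theta> / 2))^2)) = g (Suc i) * laplacian_ev N h (Suc k)"
    by (simp add: laplacian_ev_def \<theta>_def mult.commute del: of_nat_Suc)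
  also have "\<dots> = (sine_mat N * mat_diag (N - 1) (\<lambda>k. laplacian_ev N h (Suc k))) $$ (i, k)"
    unfolding mat_diag_mult_right[OF sine_mat_carrier] using ik by (simp add: Q[symmetric])
  finally show "(laplacian N h * sine_mat N) $$ (i, k)
      = (sine_mat N * mat_diag (N - 1) (\<lambda>k. laplacian_ev N h (Suc k))) $$ (i, k)" .
qed (simp_all add: laplacian_def sine_mat_def mat_diag_def)

lemma laplacian_diagonalisation:
  "laplacian N h =
     sine_mat N * mat_diag (N - 1) (\<lambda>k. laplacian_ev N h (Suc k)) * transpose_mat (sine_mat N)"
proof -
  have L: "laplacian N h \<in> carrier_mat (N - 1) (N - 1)" by (simp add: laplacian_def)
  have Qt: "transpose_mat (sine_mat N) \<in> carrier_mat (N - 1) (N - 1)"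
    by (simp only: transpose_carrier_mat sine_mat_carrier)
  have "laplacian N h = laplacian N h * (sine_mat N * transpose_mat (sine_mat N))"
    unfolding sine_mat_orth' using L by (rule right_mult_one_mat[symmetric])
  also have "\<dots> = laplacian N h * sine_mat N * transpose_mat (sine_mat N)"
    by (rule assoc_mult_mat[OF L sine_mat_carrier Qt, symmetric])
  finally show ?thesis unfolding laplacian_sine_mat .
qed

lemma laplacian_ev_pos:
  assumes "0 < k" "k < N" "h \<noteq> 0"
  shows "laplacian_ev N h k > 0"
proof -
  have "real k * pi / (2 * real N) < pi"
    using assms by (simp add: divide_less_eq)
  then have "sin (real k * pi / (2 * real N)) > 0"
    using assms by (intro sin_gt_zero) auto
  then show ?thesis using assms by (simp add: laplacian_ev_def)
qed

lemma mat_inverse_frac_laplacian: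
  assumes "h \<noteq> 0"
  shows "mat_inverse (frac_laplacian N h s) = Some (frac_laplacian N h (- s))"
proof -
  let ?n = "N - 1" and ?Q = "sine_mat N" and ?Qt = "transpose_mat (sine_mat N)"
  let ?D = "\<lambda>s. mat_diag (N - 1) (\<lambda>k. laplacian_ev N h (Suc k) powr s)"
  have Q: "?Q \<in> carrier_mat ?n ?n" by (rule sine_mat_carrier)
  have Qt: "?Qt \<in> carrier_mat ?n ?n" by (simp only: transpose_carrier_mat Q)
  have D: "?D s \<in> carrier_mat ?n ?n" for s by (rule mat_diag_dim)
  have A: "frac_laplacian N h s \<in> carrier_mat ?n ?n" for s
    unfolding frac_laplacian_def by (intro mult_carrier_mat[OF mult_carrier_mat[OF Q D] Qt])
  have DD: "?D s * ?D (- s) = 1\<^sub>m ?n" for s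
    unfolding mat_diag_diag
  proof (rule eq_matI)
    fix i j assume "i < dim_row (1\<^sub>m ?n :: real mat)" "j < dim_col (1\<^sub>m ?n :: real mat)"
    then have ij: "i < ?n" "j < ?n" by simp_all
    then have "laplacian_ev N h (Suc j) > 0" using assms by (intro laplacian_ev_pos) auto
    then have "laplacian_ev N h (Suc j) powr s * laplacian_ev N h (Suc j) powr (- s) = 1"
      by (simp only: powr_add[symmetric]) simp
    then show "mat_diag ?n (\<lambda>k. laplacian_ev N h (Suc k) powr s * laplacian_ev N h (Suc k) powr (- s)) $$ (i, j)
        = 1\<^sub>m ?n $$ (i, j)"
      using ij by (simp add: mat_diag_def)
  qed (simp_all add: mat_diag_def)
  have inv: "frac_laplacian N h s * frac_laplacian N h (- s) = 1\<^sub>m ?n" for s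
  proof -
    have "frac_laplacian N h s * frac_laplacian N h (- s) = ?Q * ?D s * (?Qt * (?Q * ?D (- s) * ?Qt))"
      unfolding frac_laplacian_def
      by (rule assoc_mult_mat[OF mult_carrier_mat[OF Q D] Qt mult_carrier_mat[OF mult_carrier_mat[OF Q D] Qt]])
    also have "?Q * ?D (- s) * ?Qt = ?Q * (?D (- s) * ?Qt)" by (rule assoc_mult_mat[OF Q D Qt])
    also have "?Qt * (?Q * (?D (- s) * ?Qt)) = ?Qt * ?Q * (?D (- s) * ?Qt)"
      by (rule assoc_mult_mat[OF Qt Q mult_carrier_mat[OF D Qt], symmetric])
    also have "\<dots> = ?D (- s) * ?Qt"
      unfolding sine_mat_orth by (rule left_mult_one_mat[OF mult_carrier_mat[OF D Qt]])
    also have "?Q * ?D s * (?D (- s) * ?Qt) = ?Q * (?D s * (?D (- s) * ?Qt))"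
      by (rule assoc_mult_mat[OF Q D mult_carrier_mat[OF D Qt]])
    also have "?D s * (?D (- s) * ?Qt) = ?D s * ?D (- s) * ?Qt"
      by (rule assoc_mult_mat[OF D D Qt, symmetric])
    also have "\<dots> = ?Qt" unfolding DD by (rule left_mult_one_mat[OF Qt])
    finally show ?thesis unfolding sine_mat_orth' .
  qed
  show ?thesis
  proof (cases "mat_inverse (frac_laplacian N h s)")
    case None
    have "frac_laplacian N h s \<in> Units (ring_mat TYPE(real) ?n ())"
      unfolding Units_def ring_mat_def using A[of s] A[of "- s"] inv[of s] inv[of "- s"] by auto
    then show ?thesis using mat_inverse(1)[OF A None, of "()"] by blast
  next
    case (Some B)
    from mat_inverse(2)[OF A Some] have B: "B * frac_laplacian N h s = 1\<^sub>m ?n" "B \<in> carrier_mat ?n ?n"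
      by auto
    have "B = B * (frac_laplacian N h s * frac_laplacian N h (- s))"
      unfolding inv using B(2) by (rule right_mult_one_mat[symmetric])
    also have "\<dots> = B * frac_laplacian N h s * frac_laplacian N h (- s)"
      by (rule assoc_mult_mat[OF B(2) A A, symmetric])
    also have "\<dots> = frac_laplacian N h (- s)" unfolding B(1) by (rule left_mult_one_mat[OF A])
    finally show ?thesis using Some by simp
  qed
qed

end

theory Submission
  imports Defs "HOL-Analysis.L2_Norm"
begin

text \<open>
  Testing the scheme with the midpoint \<open>U^{n+1/2}\<close> gives the energy identity
  \<open>\<parallel>U^{n+1}\<parallel>\<^sup>2 + 2\<tau>\<parallel>U^{n+1/2}\<parallel>\<^sub>A\<^sup>2 = \<parallel>U^n\<parallel>\<^sup>2 + 2\<tau> r \<langle>F, U^{n+1/2}\<rangle>\<close>, because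
  \<open>\<langle>U^{n+1} - U^n, U^{n+1} + U^n\<rangle>\<close> telescopes. Part (i) is the case \<open>F = 0\<close>. For (ii), drop the
  \<open>A\<close>-term, use Cauchy-Schwarz and divide by \<open>\<parallel>U^{n+1}\<parallel> + \<parallel>U^n\<parallel>\<close>. For (iii), use
  \<open>2 r \<langle>F, v\<rangle> \<le> \<langle>A v, v\<rangle> + r\<^sup>2 \<langle>A^{-1} F, F\<rangle>\<close>, which is Young's inequality applied to each
  sine coefficient.
\<close>

section \<open>Cauchy-Schwarz and triangle inequality for the grid norm\<close>

lemma scalar_prod_self_nonneg: "(v :: real vec) \<bullet> v \<ge> 0"
  by (simp add: scalar_prod_def sum_nonneg)

lemma norm_h_power2:
  assumes "h \<ge> 0"
  shows "(norm_h h v)\<^sup>2 = inner_h h v v"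
  unfolding norm_h_def using assms by (simp add: inner_h_def scalar_prod_self_nonneg)

lemma norm_h_nonneg:
  assumes "h \<ge> 0"
  shows "norm_h h v \<ge> 0"
  unfolding norm_h_def using assms by (simp add: inner_h_def scalar_prod_self_nonneg)

text \<open>Up to the factor \<open>sqrt h\<close> the grid norm is Euclidean, so Cauchy-Schwarz and
  Minkowski can be taken over from \<open>L2_set\<close>.\<close>

lemma norm_h_eq_L2_set:
  "norm_h h v = sqrt h * L2_set (vec_index v) {0..<dim_vec v}"
  by (simp add: norm_h_def inner_h_def scalar_prod_def L2_set_def real_sqrt_mult power2_eq_square)

lemma inner_h_Cauchy_Schwarz:
  assumes "h \<ge> 0" "v \<in> carrier_vec n" "w \<in> carrier_vec n"
  shows "\<bar>inner_h h v w\<bar> \<le> norm_h h v * norm_h h w"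
proof -
  have "\<bar>v \<bullet> w\<bar> \<le> (\<Sum>i = 0..<n. \<bar>v $ i\<bar> * \<bar>w $ i\<bar>)"
    using assms sum_abs[of "\<lambda>i. v $ i * w $ i" "{0..<n}"] by (simp add: scalar_prod_def abs_mult)
  also have "\<dots> \<le> L2_set (vec_index v) {0..<n} * L2_set (vec_index w) {0..<n}"
    by (rule L2_set_mult_ineq)
  finally have "h * \<bar>v \<bullet> w\<bar> \<le> h * (L2_set (vec_index v) {0..<n} * L2_set (vec_index w) {0..<n})"
    using assms(1) by (rule mult_left_mono)
  \<comment> \<open>One factor \<open>sqrt h\<close> goes to each of the two norms.\<close>
  also have "\<dots> = (sqrt h * sqrt h) * (L2_set (vec_index v) {0..<n} * L2_set (vec_index w) {0..<n})"
    using assms(1) by simp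
  also have "\<dots> = norm_h h v * norm_h h w"
    using assms(2,3) unfolding norm_h_eq_L2_set by (simp only: carrier_vecD mult_ac)
  finally show ?thesis
    using assms(1) by (simp add: inner_h_def abs_mult)
qed

text \<open>Minkowski's inequality. The sum of the two end norms on the right later cancels against
  the same factor of a difference of squares.\<close>

lemma norm_h_midpoint_le:
  assumes "h \<ge> 0" "v \<in> carrier_vec n" "w \<in> carrier_vec n"
  shows "norm_h h ((1 / 2) \<cdot>\<^sub>v (v + w)) \<le> (norm_h h v + norm_h h w) / 2"
proof -
  have "norm_h h ((1 / 2) \<cdot>\<^sub>v (v + w)) = sqrt h * L2_set (\<lambda>i. 1 / 2 * (v $ i + w $ i)) {0..<n}"
    unfolding norm_h_eq_L2_set using assms(2,3) by (intro arg_cong2[where f="(*)"] L2_set_cong) auto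
  also have "\<dots> = sqrt h * L2_set (\<lambda>i. v $ i + w $ i) {0..<n} / 2"
    by (subst L2_set_right_distrib[symmetric]) simp_all
  also have "\<dots> \<le> sqrt h * (L2_set (vec_index v) {0..<n} + L2_set (vec_index w) {0..<n}) / 2"
    using assms(1) by (intro divide_right_mono mult_left_mono L2_set_triangle_ineq) simp_all
  finally show ?thesis
    using assms(2,3) by (simp add: norm_h_eq_L2_set distrib_left)
qed

section \<open>Sine coefficients and the spectral form of the fractional Laplacian\<close>

lemma frac_laplacian_carrier: "frac_laplacian N h s \<in> carrier_mat (N - 1) (N - 1)"
  unfolding frac_laplacian_def
  by (intro mult_carrier_mat[of _ _ "N - 1"]) (simp_all only: sine_mat_carrier transpose_carrier_mat mat_diag_dim)

text \<open>Coordinates in the orthonormal eigenbasis formed by the columns of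
  \<open>sine_mat N\<close>; position \<open>k\<close> belongs to the mathematical index
  \<open>Suc k\<close>.\<close>

definition sine_coeff :: "nat \<Rightarrow> real vec \<Rightarrow> nat \<Rightarrow> real" where
  "sine_coeff N v k = (transpose_mat (sine_mat N) *\<^sub>v v) $ k"

text \<open>Parseval's identity: insert \<open>Q * Q^T = I\<close> in front of \<open>v\<close> and
  move the outer \<open>Q\<close> to the other side of the product as its transpose.\<close>

lemma scalar_prod_sine_coeff:
  assumes v: "v \<in> carrier_vec (N - 1)" and w: "w \<in> carrier_vec (N - 1)"
  shows "v \<bullet> w = (\<Sum>k<N - 1. sine_coeff N v k * sine_coeff N w k)"
proof -
  let ?Q = "sine_mat N" and ?Qt = "transpose_mat (sine_mat N)"
  have Qt: "?Qt \<in> carrier_mat (N - 1) (N - 1)"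
    by (simp only: transpose_carrier_mat sine_mat_carrier)
  have "v = ?Q * ?Qt *\<^sub>v v" using v by (simp add: sine_mat_orth')
  also have "\<dots> = ?Q *\<^sub>v (?Qt *\<^sub>v v)"
    by (rule assoc_mult_mat_vec[OF sine_mat_carrier Qt v])
  finally have "v \<bullet> w = (?Q *\<^sub>v (?Qt *\<^sub>v v)) \<bullet> w" by simp
  also have "\<dots> = (?Qt *\<^sub>v v) \<bullet> (?Qt *\<^sub>v w)"
    using transpose_vec_mult_scalar[OF Qt w, of "?Qt *\<^sub>v v"] Qt v by simp
  also have "\<dots> = (\<Sum>k<N - 1. sine_coeff N v k * sine_coeff N w k)"
    using Qt by (simp add: scalar_prod_def sine_coeff_def atLeast0LessThan)
  finally show ?thesis .
qed

lemma mat_diag_mult_vec_index: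
  fixes w :: "'a :: semiring_1 vec"
  assumes "w \<in> carrier_vec n" "k < n"
  shows "(mat_diag n d *\<^sub>v w) $ k = d k * w $ k"
  using assms by (simp add: mat_diag_def scalar_prod_def if_distrib[of "\<lambda>x. x * _"] cong: if_cong)

text \<open>Applying \<open>Q^T\<close> to \<open>Q D Q^T v\<close> cancels \<open>Q^T Q\<close> and
  leaves the diagonal factor. The exponent is an arbitrary real, so \<open>- s\<close> later serves
  the inverse matrix.\<close>

lemma sine_coeff_frac_laplacian:
  assumes v: "v \<in> carrier_vec (N - 1)" and k: "k < N - 1"
  shows "sine_coeff N (frac_laplacian N h s *\<^sub>v v) k = laplacian_ev N h (Suc k) powr s * sine_coeff N v k"
proof -
  let ?n = "N - 1" and ?Q = "sine_mat N" and ?Qt = "transpose_mat (sine_mat N)"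
  let ?D = "mat_diag ?n (\<lambda>k. laplacian_ev N h (Suc k) powr s)"
  have Qt: "?Qt \<in> carrier_mat ?n ?n"
    by (simp only: transpose_carrier_mat sine_mat_carrier)
  have D: "?D \<in> carrier_mat ?n ?n" by (rule mat_diag_dim)
  have w: "?Qt *\<^sub>v v \<in> carrier_vec ?n" using Qt v by (rule mult_mat_vec_carrier)
  have Dw: "?D *\<^sub>v (?Qt *\<^sub>v v) \<in> carrier_vec ?n" using D w by (rule mult_mat_vec_carrier)
  have "frac_laplacian N h s *\<^sub>v v = ?Q *\<^sub>v (?D *\<^sub>v (?Qt *\<^sub>v v))"
    unfolding frac_laplacian_def
    by (simp only: assoc_mult_mat_vec[OF mult_carrier_mat[OF sine_mat_carrier D] Qt v]
        assoc_mult_mat_vec[OF sine_mat_carrier D w])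
  then have "?Qt *\<^sub>v (frac_laplacian N h s *\<^sub>v v) = ?Qt * ?Q *\<^sub>v (?D *\<^sub>v (?Qt *\<^sub>v v))"
    by (simp only: assoc_mult_mat_vec[OF Qt sine_mat_carrier Dw])
  also have "\<dots> = ?D *\<^sub>v (?Qt *\<^sub>v v)"
    unfolding sine_mat_orth using Dw by (rule one_mult_mat_vec)
  finally have "sine_coeff N (frac_laplacian N h s *\<^sub>v v) k = (?D *\<^sub>v (?Qt *\<^sub>v v)) $ k"
    unfolding sine_coeff_def by simp
  then show ?thesis
    using mat_diag_mult_vec_index[OF w k] by (simp add: sine_coeff_def)
qed

lemma inner_h_frac_laplacian:
  assumes v: "v \<in> carrier_vec (N - 1)"
  shows "inner_h h (frac_laplacian N h s *\<^sub>v v) v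
    = h * (\<Sum>k<N - 1. laplacian_ev N h (Suc k) powr s * (sine_coeff N v k)\<^sup>2)"
  unfolding inner_h_def
  by (subst scalar_prod_sine_coeff[OF mult_mat_vec_carrier[OF frac_laplacian_carrier v] v])
    (simp add: sine_coeff_frac_laplacian[OF v] power2_eq_square mult.assoc)

text \<open>Squaring undoes the root because the form is nonnegative: its spectral sum has weights
  \<open>powr\<close>, which are nonnegative for exponents of either sign.\<close>

lemma mat_norm_h_frac_laplacian_power2:
  assumes "h \<ge> 0" "v \<in> carrier_vec (N - 1)"
  shows "(mat_norm_h h (frac_laplacian N h s) v)\<^sup>2 = inner_h h (frac_laplacian N h s *\<^sub>v v) v"
  unfolding mat_norm_h_def using assms
  by (simp add: inner_h_frac_laplacian sum_nonneg)

section \<open>Young's inequality and the duality of the two weighted norms\<close>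

lemma Young_weighted:
  fixes a b c :: real
  assumes "c > 0"
  shows "2 * (a * b) \<le> c powr s * b\<^sup>2 + c powr (- s) * a\<^sup>2"
proof -
  \<comment> \<open>With the square root of the weight, the cross term of
    \<open>(p * b - 1 / p * a)\<^sup>2\<close> is exactly \<open>2 * (a * b)\<close>.\<close>
  define p where "p = c powr (s / 2)"
  have p: "p > 0" using assms by (simp add: p_def)
  have c: "c powr s = p\<^sup>2"
    using assms by (simp add: p_def power2_eq_square powr_add[symmetric])
  have c': "c powr (- s) = (1 / p)\<^sup>2"
    using assms by (simp add: p_def power2_eq_square powr_add[symmetric] powr_minus divide_simps)
  have "0 \<le> (p * b - 1 / p * a)\<^sup>2" by simp
  moreover have "(p * b - 1 / p * a)\<^sup>2 = p\<^sup>2 * b\<^sup>2 + (1 / p)\<^sup>2 * a\<^sup>2 - 2 * (a * b)"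
    using p by (simp add: power2_diff power_mult_distrib power_divide)
  ultimately show ?thesis unfolding c c' by linarith
qed

lemma inner_h_le_dual_norms:
  assumes h: "h > 0" and F: "F \<in> carrier_vec (N - 1)" and v: "v \<in> carrier_vec (N - 1)"
  shows "2 * (c * inner_h h F v) \<le> (mat_norm_h h (frac_laplacian N h s) v)\<^sup>2
    + \<bar>c\<bar>\<^sup>2 * (mat_norm_h h (frac_laplacian_inv N h s) F)\<^sup>2"
proof -
  let ?n = "N - 1" and ?e = "\<lambda>k. laplacian_ev N h (Suc k)"
  let ?F = "sine_coeff N F" and ?v = "sine_coeff N v"
  \<comment> \<open>The scalar \<open>c\<close> is grouped with the coefficient of \<open>F\<close>,
    so its square falls on the dual norm alone. The weight is positive since
    \<open>k < N - 1\<close> puts \<open>Suc k\<close> strictly between \<open>0\<close> and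
    \<open>N\<close>.\<close>
  have "2 * (c * ?F k * ?v k) \<le> ?e k powr s * (?v k)\<^sup>2 + c\<^sup>2 * (?e k powr (- s) * (?F k)\<^sup>2)"
    if "k < ?n" for k
    using Young_weighted[OF laplacian_ev_pos[of "Suc k" N h], of "c * ?F k" "?v k" s] that h
    by (simp add: power_mult_distrib mult_ac)
  then have "(\<Sum>k<?n. 2 * (c * ?F k * ?v k))
      \<le> (\<Sum>k<?n. ?e k powr s * (?v k)\<^sup>2 + c\<^sup>2 * (?e k powr (- s) * (?F k)\<^sup>2))"
    by (intro sum_mono) simp
  then have "2 * (c * (F \<bullet> v)) \<le> (\<Sum>k<?n. ?e k powr s * (?v k)\<^sup>2)
      + c\<^sup>2 * (\<Sum>k<?n. ?e k powr (- s) * (?F k)\<^sup>2)"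
    by (simp add: scalar_prod_sine_coeff[OF F v] sum.distrib sum_distrib_left mult.assoc)
  then have "h * (2 * (c * (F \<bullet> v))) \<le> h * ((\<Sum>k<?n. ?e k powr s * (?v k)\<^sup>2)
      + c\<^sup>2 * (\<Sum>k<?n. ?e k powr (- s) * (?F k)\<^sup>2))"
    using h by (intro mult_left_mono) simp_all
  \<comment> \<open>The inverse is the power \<open>- s\<close>, so the second sum is the squared
    dual norm.\<close>
  moreover have "frac_laplacian_inv N h s = frac_laplacian N h (- s)"
    using h by (simp add: frac_laplacian_inv_def mat_inverse_frac_laplacian)
  ultimately show ?thesis
    using mat_norm_h_frac_laplacian_power2[of h F N "- s"] mat_norm_h_frac_laplacian_power2[of h v N s] h
      inner_h_frac_laplacian[OF F, of h "- s"] inner_h_frac_laplacian[OF v, of h s] F v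
    by (simp add: inner_h_def[of h F v] algebra_simps)
qed

section \<open>One step of the Crank-Nicolson scheme\<close>

lemma midpoint_vec_carrier:
  assumes "U n \<in> carrier_vec m" "U (Suc n) \<in> carrier_vec m"
  shows "midpoint_vec U n \<in> carrier_vec m"
  using assms by (simp add: midpoint_vec_def)

lemma forcing_carrier: "forcing N h \<tau> f n \<in> carrier_vec (N - 1)"
  by (simp add: forcing_def)

text \<open>The factor 2 absorbs the half in the midpoint, and the cross terms cancel by symmetry of
  the scalar product.\<close>

lemma inner_h_diff_midpoint:
  assumes U: "U n \<in> carrier_vec m" "U (Suc n) \<in> carrier_vec m"
  shows "2 * inner_h h (U (Suc n) - U n) (midpoint_vec U n)
    = inner_h h (U (Suc n)) (U (Suc n)) - inner_h h (U n) (U n)"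
proof -
  have "2 * ((U (Suc n) - U n) \<bullet> midpoint_vec U n) = (U (Suc n) - U n) \<bullet> (U (Suc n) + U n)"
    using U by (simp add: midpoint_vec_def)
  also have "\<dots> = U (Suc n) \<bullet> U (Suc n) - U n \<bullet> U n"
    using U comm_scalar_prod[OF U] by (simp add: minus_scalar_prod_distrib[of _ m] scalar_prod_add_distrib[of _ m])
  finally have "h * (2 * ((U (Suc n) - U n) \<bullet> midpoint_vec U n))
      = h * (U (Suc n) \<bullet> U (Suc n) - U n \<bullet> U n)"
    by simp
  then show ?thesis
    by (simp add: inner_h_def algebra_simps)
qed

lemma crank_nicolson_energy_identity:
  assumes h: "h \<ge> 0" and \<tau>: "\<tau> \<noteq> 0" and cn: "crank_nicolson N M h \<tau> s r f U" and n: "n < M"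
  shows "(norm_h h (U (Suc n)))\<^sup>2
      + 2 * \<tau> * (mat_norm_h h (frac_laplacian N h s) (midpoint_vec U n))\<^sup>2
    = (norm_h h (U n))\<^sup>2
      + 2 * \<tau> * (r (half_time \<tau> n) * inner_h h (forcing N h \<tau> f n) (midpoint_vec U n))"
proof -
  let ?m = "midpoint_vec U n" and ?F = "forcing N h \<tau> f n" and ?A = "frac_laplacian N h s"
  have U: "U n \<in> carrier_vec (N - 1)" "U (Suc n) \<in> carrier_vec (N - 1)"
    using cn n by (auto simp: crank_nicolson_def)
  have m: "?m \<in> carrier_vec (N - 1)" using U by (rule midpoint_vec_carrier)
  have Am: "?A *\<^sub>v ?m \<in> carrier_vec (N - 1)"
    using frac_laplacian_carrier m by (rule mult_mat_vec_carrier)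
  have "((1 / \<tau>) \<cdot>\<^sub>v (U (Suc n) - U n) + ?A *\<^sub>v ?m) \<bullet> ?m = (r (half_time \<tau> n) \<cdot>\<^sub>v ?F) \<bullet> ?m"
    using cn n by (simp add: crank_nicolson_def)
  then have "1 / \<tau> * ((U (Suc n) - U n) \<bullet> ?m) + (?A *\<^sub>v ?m) \<bullet> ?m = r (half_time \<tau> n) * (?F \<bullet> ?m)"
    using U m Am forcing_carrier[of N h \<tau> f n] by (simp add: add_scalar_prod_distrib[of _ "N - 1"])
  then have "(U (Suc n) - U n) \<bullet> ?m + \<tau> * ((?A *\<^sub>v ?m) \<bullet> ?m) = \<tau> * (r (half_time \<tau> n) * (?F \<bullet> ?m))"
    using \<tau> by (simp add: field_simps)
  \<comment> \<open>The factor \<open>h\<close> turns scalar products into grid products; the 2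
    prepares the difference of squares.\<close>
  then have "2 * h * ((U (Suc n) - U n) \<bullet> ?m + \<tau> * ((?A *\<^sub>v ?m) \<bullet> ?m))
      = 2 * h * (\<tau> * (r (half_time \<tau> n) * (?F \<bullet> ?m)))"
    by simp
  then have "2 * inner_h h (U (Suc n) - U n) ?m + 2 * \<tau> * inner_h h (?A *\<^sub>v ?m) ?m
      = 2 * \<tau> * (r (half_time \<tau> n) * inner_h h ?F ?m)"
    by (simp add: inner_h_def algebra_simps)
  then show ?thesis
    using inner_h_diff_midpoint[of U n "N - 1" h, OF U] h m
    by (simp add: norm_h_power2 mat_norm_h_frac_laplacian_power2)
qed

text \<open>The difference of squares and the bound on the forcing term share the factor
  \<open>?a + ?b\<close>; cancelling it leaves a bound linear in the norms, which can be summed over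
  the steps.\<close>

lemma crank_nicolson_norm_step:
  assumes h: "h \<ge> 0" and \<tau>: "\<tau> > 0" and cn: "crank_nicolson N M h \<tau> s r f U" and n: "n < M"
  shows "norm_h h (U (Suc n))
    \<le> norm_h h (U n) + \<tau> * \<bar>r (half_time \<tau> n)\<bar> * norm_h h (forcing N h \<tau> f n)"
proof -
  let ?m = "midpoint_vec U n" and ?F = "forcing N h \<tau> f n" and ?r = "r (half_time \<tau> n)"
  let ?a = "norm_h h (U (Suc n))" and ?b = "norm_h h (U n)" and ?c = "\<tau> * \<bar>?r\<bar> * norm_h h ?F"
  have U: "U n \<in> carrier_vec (N - 1)" "U (Suc n) \<in> carrier_vec (N - 1)"
    using cn n by (auto simp: crank_nicolson_def)
  have m: "?m \<in> carrier_vec (N - 1)" using U by (rule midpoint_vec_carrier)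
  have nn: "?a \<ge> 0" "?b \<ge> 0" "?c \<ge> 0"
    using h \<tau> by (simp_all add: norm_h_nonneg)
  have "?r * inner_h h ?F ?m \<le> \<bar>?r\<bar> * \<bar>inner_h h ?F ?m\<bar>"
    by (simp add: abs_mult[symmetric])
  also have "\<dots> \<le> \<bar>?r\<bar> * (norm_h h ?F * norm_h h ?m)"
    using inner_h_Cauchy_Schwarz[OF h forcing_carrier m] by (intro mult_left_mono) simp_all
  also have "\<dots> \<le> \<bar>?r\<bar> * (norm_h h ?F * ((?a + ?b) / 2))"
    using norm_h_midpoint_le[OF h U(2,1)] h
    by (intro mult_left_mono) (simp_all add: midpoint_vec_def norm_h_nonneg)
  finally have "2 * \<tau> * (?r * inner_h h ?F ?m) \<le> 2 * \<tau> * (\<bar>?r\<bar> * (norm_h h ?F * ((?a + ?b) / 2)))"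
    using \<tau> by (intro mult_left_mono) simp_all
  then have rhs: "2 * \<tau> * (?r * inner_h h ?F ?m) \<le> ?c * (?a + ?b)"
    by (simp add: algebra_simps)
  have "2 * \<tau> * (mat_norm_h h (frac_laplacian N h s) ?m)\<^sup>2 \<ge> 0"
    using \<tau> by simp
  then have "?a\<^sup>2 - ?b\<^sup>2 \<le> ?c * (?a + ?b)"
    using crank_nicolson_energy_identity[OF h _ cn n] \<tau> rhs by linarith
  then have *: "(?a - ?b) * (?a + ?b) \<le> ?c * (?a + ?b)"
    by (simp add: power2_eq_square algebra_simps)
  show ?thesis
  \<comment> \<open>If the sum is not positive, both norms vanish and the bound is trivial.\<close>
  proof (cases "?a + ?b > 0")
    case True
    then have "?a - ?b \<le> ?c" using * by (simp only: mult_le_cancel_right_pos)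
    then show ?thesis by simp
  next
    case False
    then show ?thesis using nn by linarith
  qed
qed

text \<open>The identity carries the dissipation twice; Young's inequality spends one copy on the
  forcing and the other stays on the left.\<close>

lemma crank_nicolson_energy_step:
  assumes h: "h > 0" and \<tau>: "\<tau> > 0" and cn: "crank_nicolson N M h \<tau> s r f U" and n: "n < M"
  shows "(norm_h h (U (Suc n)))\<^sup>2
      + \<tau> * (mat_norm_h h (frac_laplacian N h s) (midpoint_vec U n))\<^sup>2
    \<le> (norm_h h (U n))\<^sup>2
      + \<tau> * \<bar>r (half_time \<tau> n)\<bar>\<^sup>2 * (mat_norm_h h (frac_laplacian_inv N h s) (forcing N h \<tau> f n))\<^sup>2"
proof -
  let ?m = "midpoint_vec U n" and ?F = "forcing N h \<tau> f n" and ?r = "r (half_time \<tau> n)"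
  have m: "?m \<in> carrier_vec (N - 1)"
    using cn n by (intro midpoint_vec_carrier) (auto simp: crank_nicolson_def)
  have "\<tau> * (2 * (?r * inner_h h ?F ?m)) \<le> \<tau> * ((mat_norm_h h (frac_laplacian N h s) ?m)\<^sup>2
      + \<bar>?r\<bar>\<^sup>2 * (mat_norm_h h (frac_laplacian_inv N h s) ?F)\<^sup>2)"
    using inner_h_le_dual_norms[OF h forcing_carrier m] \<tau> by (intro mult_left_mono) simp_all
  then show ?thesis
    using crank_nicolson_energy_identity[OF _ _ cn n] h \<tau> by (simp add: algebra_simps)
qed

theorem theorem4p2:
  fixes l T s h \<tau> :: real and N M :: nat
    and r :: "real \<Rightarrow> real" and f :: "real \<Rightarrow> real \<Rightarrow> real" and U :: "nat \<Rightarrow> real vec"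
  assumes "l > 0" and "T > 0" and "0 < s" and "s < 1" and "N \<ge> 2" and "M \<ge> 1"
    and "h = l / real N" and "\<tau> = T / real M"
    and "crank_nicolson N M h \<tau> s r f U"
  shows "(\<forall>n<M. forcing N h \<tau> f n = 0\<^sub>v (N - 1) \<longrightarrow>
            (norm_h h (U (Suc n)))\<^sup>2
              + 2 * \<tau> * (mat_norm_h h (frac_laplacian N h s) (midpoint_vec U n))\<^sup>2
            = (norm_h h (U n))\<^sup>2)
       \<and> (\<forall>n\<le>M. norm_h h (U n)
            \<le> norm_h h (U 0)
              + (\<Sum>k<n. \<tau> * \<bar>r (half_time \<tau> k)\<bar> * norm_h h (forcing N h \<tau> f k)))
       \<and> (\<forall>n\<le>M. (norm_h h (U n))\<^sup>2
              + (\<Sum>k<n. \<tau> * (mat_norm_h h (frac_laplacian N h s) (midpoint_vec U k))\<^sup>2)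
            \<le> (norm_h h (U 0))\<^sup>2
              + (\<Sum>k<n. \<tau> * \<bar>r (half_time \<tau> k)\<bar>\<^sup>2
                    * (mat_norm_h h (frac_laplacian_inv N h s) (forcing N h \<tau> f k))\<^sup>2))"
proof (intro conjI allI impI)
  \<comment> \<open>Positivity of both mesh sizes is all that the step estimates ask of them, so no
    bound relates \<open>\<tau>\<close> to \<open>h\<close>.\<close>
  have h: "h > 0" and \<tau>: "\<tau> > 0" using assms by simp_all
  have cn: "crank_nicolson N M h \<tau> s r f U" by fact
  {
    fix n assume n: "n < M" and F: "forcing N h \<tau> f n = 0\<^sub>v (N - 1)"
    have "U n \<in> carrier_vec (N - 1)" "U (Suc n) \<in> carrier_vec (N - 1)"
      using cn n by (auto simp: crank_nicolson_def)
    then have "inner_h h (forcing N h \<tau> f n) (midpoint_vec U n) = 0"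
      using midpoint_vec_carrier unfolding F inner_h_def by (metis mult_zero_right scalar_prod_left_zero)
    then show "(norm_h h (U (Suc n)))\<^sup>2
        + 2 * \<tau> * (mat_norm_h h (frac_laplacian N h s) (midpoint_vec U n))\<^sup>2 = (norm_h h (U n))\<^sup>2"
      using crank_nicolson_energy_identity[OF _ _ cn n] h \<tau> by simp
  next
    fix n assume "n \<le> M"
    then show "norm_h h (U n) \<le> norm_h h (U 0)
        + (\<Sum>k<n. \<tau> * \<bar>r (half_time \<tau> k)\<bar> * norm_h h (forcing N h \<tau> f k))"
    \<comment> \<open>The one-step bounds are chained; \<open>Suc n \<le> M\<close> gives the
      \<open>n < M\<close> under which the scheme holds.\<close>
    proof (induction n)
      case (Suc n)
      then show ?case using crank_nicolson_norm_step[OF _ \<tau> cn, of n] h by simp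
    qed simp
  next
    fix n assume "n \<le> M"
    then show "(norm_h h (U n))\<^sup>2
        + (\<Sum>k<n. \<tau> * (mat_norm_h h (frac_laplacian N h s) (midpoint_vec U k))\<^sup>2)
      \<le> (norm_h h (U 0))\<^sup>2 + (\<Sum>k<n. \<tau> * \<bar>r (half_time \<tau> k)\<bar>\<^sup>2
          * (mat_norm_h h (frac_laplacian_inv N h s) (forcing N h \<tau> f k))\<^sup>2)"
    proof (induction n)
      case (Suc n)
      then show ?case using crank_nicolson_energy_step[OF h \<tau> cn, of n]
        by (simp del: power2_abs)
    qed simp
  }
qed

end
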